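(* Let $T$ be a tree with at least two vertices and even diameter. Then the eigenvalues of the eccentricity matrix $\mathcal{E}(T)$ are not symmetric about the origin; that is, there is a real number $\lambda$ whose multiplicity as an eigenvalue of $\mathcal{E}(T)$ differs from the multiplicity of $-\lambda$ (multiplicity $0$ meaning not an eigenvalue).
   Context: For a connected graph $G$ with distance function $d(u,v)$, the eccentricity of a vertex $u$ is $e(u)=\max_{v}d(u,v)$. The eccentricity matrix $\mathcal{E}(G)$ is the matrix indexed by $V(G)$ with $\mathcal{E}(G)_{uv}=d(u,v)$ if $d(u,v)=\min\{e(u),e(v)\}$, and $\mathcal{E}(G)_{uv}=0$ otherwise. The diameter is the largest distance between two vertices. *)

theory Defs
  imports
    "Graph_Theory.Graph_Theory"
    "Jordan_Normal_Form.Char_Poly"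
begin

text \<open>
  Finite simple undirected graphs are the symmetric digraphs of the locale \<open>graph\<close>, in which
  every edge is a pair of opposite arcs. The predicates \<open>forest\<close> and \<open>tree\<close> of the
  library forbid all directed cycles, hence also the closed walk \<open>a, b, a\<close> along a single edge, so
  they are not usable for undirected trees. A cycle of an undirected simple graph is a directed
  cycle of length at least 3.
\<close>

definition undirected_tree :: "('a, 'b) pre_digraph \<Rightarrow> bool" where
  "undirected_tree G \<longleftrightarrow>
     graph G \<and> connected G \<and> \<not> (\<exists>p. pre_digraph.cycle G p \<and> 3 \<le> length p)"

definition graph_dist :: "('a, 'b) pre_digraph \<Rightarrow> 'a \<Rightarrow> 'a \<Rightarrow> nat" where
  "graph_dist G u v = (LEAST n. \<exists>p. pre_digraph.awalk G u p v \<and> length p = n)"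

definition eccentricity :: "('a, 'b) pre_digraph \<Rightarrow> 'a \<Rightarrow> nat" where
  "eccentricity G u = Max {graph_dist G u v | v. v \<in> verts G}"

definition graph_diameter :: "('a, 'b) pre_digraph \<Rightarrow> nat" where
  "graph_diameter G = Max {graph_dist G u v | u v. u \<in> verts G \<and> v \<in> verts G}"

text \<open>
  Library matrices are indexed by an initial segment of the naturals, so the rows and columns follow
  a list \<open>vs\<close> that enumerates the vertices without repetition. A different enumeration conjugates
  the matrix by a permutation matrix.
\<close>

definition eccentricity_matrix :: "('a, 'b) pre_digraph \<Rightarrow> 'a list \<Rightarrow> real mat" where
  "eccentricity_matrix G vs = mat (length vs) (length vs) (\<lambda>(i, j).
     if graph_dist G (vs ! i) (vs ! j)
          = min (eccentricity G (vs ! i)) (eccentricity G (vs ! j))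
     then real (graph_dist G (vs ! i) (vs ! j)) else 0)"

definition eigenvalue_multiplicity :: "real mat \<Rightarrow> real \<Rightarrow> nat" where
  "eigenvalue_multiplicity A k = Polynomial.order k (char_poly A)"

end

theory Submission
  imports Defs "Jordan_Normal_Form.Schur_Decomposition"
begin

text \<open>
  The eigenvalues of a real symmetric matrix are real, so if they are symmetric about the origin
  then the trace of every odd power vanishes. In a tree of diameter \<open>2 r\<close> let \<open>c\<close> be the
  midpoint of a diametral path from \<open>u\<close> to \<open>v\<close>. Then \<open>c\<close> has eccentricity \<open>r\<close>, so the
  entries of the eccentricity matrix at \<open>(c, u)\<close>, \<open>(c, v)\<close> and \<open>(u, v)\<close> are the positive
  distances \<open>r\<close>, \<open>r\<close> and \<open>2 r\<close>. This triangle, in a matrix with nonnegative entries, makes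
  the trace of the cube positive.
\<close>

section \<open>Traces of powers of real symmetric matrices\<close>

text \<open>For an eigenvector \<open>v\<close>, the Hermitian form of \<open>A\<close> at
  \<open>v\<close> equals \<open>k\<close> times the squared norm of \<open>v\<close>. Symmetry
  makes this form its own complex conjugate, and the squared norm is real and nonzero, so
  \<open>k\<close> equals its conjugate.\<close>

lemma real_symmetric_complex_eigenvalue_real:
  fixes A :: "real mat" and k :: complex
  assumes A: "A \<in> carrier_mat n n" and sym: "\<And>i j. i < n \<Longrightarrow> j < n \<Longrightarrow> A $$ (i, j) = A $$ (j, i)"
    and ev: "eigenvalue (map_mat of_real A) k"
  shows "k \<in> \<real>"
proof -
  let ?A = "map_mat of_real A :: complex mat"
  from ev obtain v where v: "v \<in> carrier_vec n" "v \<noteq> 0\<^sub>v n" and Av: "?A *\<^sub>v v = k \<cdot>\<^sub>v v"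
    using A unfolding eigenvalue_def eigenvector_def by auto
  have row: "(\<Sum>j<n. of_real (A $$ (i, j)) * v $ j) = k * v $ i" if "i < n" for i
  proof -
    have "(?A *\<^sub>v v) $ i = (\<Sum>j<n. of_real (A $$ (i, j)) * v $ j)"
      using that A v(1) by (auto simp: scalar_prod_def lessThan_atLeast0 intro!: sum.cong)
    then show ?thesis using that v(1) unfolding Av by simp
  qed
  define q where "q = (\<Sum>i<n. v $ i * cnj (v $ i))"
  \<comment> \<open>\<open>S\<close> is the Hermitian form and \<open>q\<close> the squared norm of
    \<open>v\<close>.\<close>
  define S where "S = (\<Sum>i<n. \<Sum>j<n. of_real (A $$ (i, j)) * v $ j * cnj (v $ i))"
  have S: "S = k * q"
    unfolding S_def q_def sum_distrib_left
    by (rule sum.cong) (simp_all add: row[symmetric] sum_distrib_right mult.assoc flip: mult.assoc)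
  have "cnj S = (\<Sum>i<n. \<Sum>j<n. of_real (A $$ (i, j)) * cnj (v $ j) * v $ i)"
    by (simp add: S_def)
  also have "\<dots> = (\<Sum>j<n. \<Sum>i<n. of_real (A $$ (i, j)) * cnj (v $ j) * v $ i)"
    by (rule sum.swap)
  also have "\<dots> = S"
    unfolding S_def by (intro sum.cong) (simp_all add: sym mult_ac)
  finally have "cnj k * cnj q = k * q" unfolding S by simp
  moreover have "cnj q = q" by (simp add: q_def mult.commute)
  moreover have "q \<noteq> 0"
  proof
    assume "q = 0"
    then have "of_real (\<Sum>i<n. (cmod (v $ i))\<^sup>2) = (0 :: complex)"
      by (simp add: q_def complex_norm_square del: of_real_power)
    then have "(\<Sum>i<n. (cmod (v $ i))\<^sup>2) = 0" by (simp only: of_real_eq_0_iff)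
    then have "\<forall>i<n. v $ i = 0" by (simp add: sum_nonneg_eq_0_iff)
    with v show False by auto
  qed
  ultimately show ?thesis by (simp add: Reals_cnj_iff)
qed

text \<open>Over the complex numbers the characteristic polynomial splits. All its roots are real,
  so the factorization is the image of a real one, and the embedding of real into complex
  polynomials is injective.\<close>

lemma real_symmetric_char_poly_splits:
  fixes A :: "real mat"
  assumes A: "A \<in> carrier_mat n n" and sym: "\<And>i j. i < n \<Longrightarrow> j < n \<Longrightarrow> A $$ (i, j) = A $$ (j, i)"
  obtains es where "char_poly A = (\<Prod>a\<leftarrow>es. [:- a, 1:])"
proof -
  let ?A = "map_mat of_real A :: complex mat"
  interpret of_real_poly_hom: map_poly_inj_comm_ring_hom "of_real :: real \<Rightarrow> complex" ..
  have cA: "?A \<in> carrier_mat n n" using A by simp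
  from char_poly_factorized[OF cA] obtain as where
    as: "char_poly ?A = (\<Prod>a\<leftarrow>as. [:- a, 1:])" by blast
  have real: "of_real (Re a) = a" if "a \<in> set as" for a
  proof -
    have "poly (char_poly ?A) a = 0"
      using that unfolding as by (auto simp: poly_prod_list prod_list_zero_iff image_iff intro!: bexI)
    then have "eigenvalue ?A a" using eigenvalue_root_char_poly[OF cA] by blast
    from real_symmetric_complex_eigenvalue_real[OF A sym this] show ?thesis by simp
  qed
  have "map_poly of_real (char_poly A) = char_poly ?A"
    by (rule of_real_hom.char_poly_hom[OF A, symmetric])
  also have "\<dots> = (\<Prod>a\<leftarrow>as. [:- of_real (Re a), 1:])"
    unfolding as using real by (metis (mono_tags, lifting) map_eq_conv)
  also have "\<dots> = map_poly of_real (\<Prod>a\<leftarrow>map Re as. [:- a, 1:])"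
    by (simp add: of_real_poly_hom.hom_prod_list o_def)
  finally have "char_poly A = (\<Prod>a\<leftarrow>map Re as. [:- a, 1:])"
    by (simp only: of_real_poly_hom.eq_iff)
  then show ?thesis using that by blast
qed

section \<open>Traces of powers as power sums of the eigenvalues\<close>

lemma trace_mult_comm:
  fixes A B :: "'a :: comm_semiring_0 mat"
  assumes "A \<in> carrier_mat n n" "B \<in> carrier_mat n n"
  shows "(\<Sum>i<n. (A * B) $$ (i, i)) = (\<Sum>i<n. (B * A) $$ (i, i))"
proof -
  have "(\<Sum>i<n. (A * B) $$ (i, i)) = (\<Sum>i<n. \<Sum>j<n. A $$ (i, j) * B $$ (j, i))"
    using assms by (auto simp: scalar_prod_def lessThan_atLeast0 intro!: sum.cong)
  also have "\<dots> = (\<Sum>j<n. \<Sum>i<n. A $$ (i, j) * B $$ (j, i))" by (rule sum.swap)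
  also have "\<dots> = (\<Sum>i<n. (B * A) $$ (i, i))"
    using assms by (auto simp: scalar_prod_def lessThan_atLeast0 mult.commute intro!: sum.cong)
  finally show ?thesis .
qed

text \<open>Writing \<open>A\<close> as \<open>P * (B * Q)\<close> with \<open>Q * P\<close> the
  identity, the trace allows \<open>P\<close> to be moved to the right end, where it cancels
  \<open>Q\<close>.\<close>

lemma trace_similar:
  fixes A B :: "'a :: comm_ring_1 mat"
  assumes A: "A \<in> carrier_mat n n" and sim: "similar_mat_wit A B P Q"
  shows "(\<Sum>i<n. A $$ (i, i)) = (\<Sum>i<n. B $$ (i, i))"
proof -
  note w = similar_mat_witD2[OF A sim]
  have "(\<Sum>i<n. A $$ (i, i)) = (\<Sum>i<n. (P * (B * Q)) $$ (i, i))"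
    using w by (simp add: assoc_mult_mat)
  also have "\<dots> = (\<Sum>i<n. (B * Q * P) $$ (i, i))"
    using w by (intro trace_mult_comm) auto
  also have "B * Q * P = B" using w by (simp add: assoc_mult_mat[of B n n Q n P n])
  finally show ?thesis .
qed

lemma upper_triangular_mult:
  fixes A B :: "'a :: semiring_0 mat"
  assumes A: "A \<in> carrier_mat n n" "upper_triangular A"
    and B: "B \<in> carrier_mat n n" "upper_triangular B"
  shows "upper_triangular (A * B)"
    and "i < n \<Longrightarrow> (A * B) $$ (i, i) = A $$ (i, i) * B $$ (i, i)"
proof -
  have entry: "(A * B) $$ (i, j) = (\<Sum>k<n. A $$ (i, k) * B $$ (k, j))" if "i < n" "j < n" for i j
    using that A B by (auto simp: scalar_prod_def lessThan_atLeast0 intro!: sum.cong)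
  \<comment> \<open>A summand can be nonzero only for \<open>i \<le> k \<le> j\<close>: no such
    \<open>k\<close> exists below the diagonal, and only \<open>k = i\<close> on it.\<close>
  have zero: "A $$ (i, k) * B $$ (k, j) = 0" if "i < n" "j < n" "k < n" "k < i \<or> j < k" for i j k
    using that A B by (auto dest: upper_triangularD)
  show "upper_triangular (A * B)"
  proof
    fix i j assume "j < i" "i < dim_row (A * B)"
    then have ij: "j < i" "i < n" "j < n" using A by auto
    show "(A * B) $$ (i, j) = 0"
      unfolding entry[OF ij(2,3)]
    proof (intro sum.neutral ballI)
      fix k assume "k \<in> {..<n}"
      then show "A $$ (i, k) * B $$ (k, j) = 0" using ij by (intro zero) auto
    qed
  qed
  show "(A * B) $$ (i, i) = A $$ (i, i) * B $$ (i, i)" if i: "i < n"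
  proof -
    have "(A * B) $$ (i, i) = (\<Sum>k\<in>{i}. A $$ (i, k) * B $$ (k, i))"
      unfolding entry[OF i i]
    proof (intro sum.mono_neutral_right ballI)
      fix k assume "k \<in> {..<n} - {i}"
      then show "A $$ (i, k) * B $$ (k, i) = 0" using i by (intro zero) auto
    qed (use i in auto)
    then show ?thesis by simp
  qed
qed

lemma upper_triangular_pow:
  fixes A :: "'a :: semiring_1 mat"
  assumes A: "A \<in> carrier_mat n n" "upper_triangular A"
  shows "upper_triangular (A ^\<^sub>m k) \<and> (\<forall>i<n. (A ^\<^sub>m k) $$ (i, i) = (A $$ (i, i)) ^ k)"
proof (induction k)
  case 0
  then show ?case using A by auto
next
  case (Suc k)
  have "A ^\<^sub>m k \<in> carrier_mat n n" using A by simp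
  with Suc A upper_triangular_mult[of "A ^\<^sub>m k" n A] show ?case
    by (auto simp: power_commutes)
qed

text \<open>A Schur decomposition makes \<open>A\<close> similar to an upper triangular matrix with
  diagonal \<open>es\<close>. Taking powers preserves the similarity and raises the diagonal entries
  to the same power.\<close>

lemma trace_pow_eq_sum_roots:
  fixes A :: "'a :: conjugatable_ordered_field mat"
  assumes A: "A \<in> carrier_mat n n" and es: "char_poly A = (\<Prod>a\<leftarrow>es. [:- a, 1:])"
  shows "(\<Sum>i<n. (A ^\<^sub>m k) $$ (i, i)) = (\<Sum>a\<leftarrow>es. a ^ k)"
proof -
  obtain B P Q where schur: "schur_decomposition A es = (B, P, Q)"
    by (cases "schur_decomposition A es")
  from schur_decomposition[OF A es schur]
  have sim: "similar_mat_wit A B P Q" and ut: "upper_triangular B" and diag: "diag_mat B = es"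
    by auto
  have B: "B \<in> carrier_mat n n" using similar_mat_witD2[OF A sim] by blast
  have "(\<Sum>i<n. (A ^\<^sub>m k) $$ (i, i)) = (\<Sum>i<n. (B ^\<^sub>m k) $$ (i, i))"
    using A by (intro trace_similar[OF _ similar_mat_wit_pow[OF sim]]) simp
  also have "\<dots> = (\<Sum>i<n. (B $$ (i, i)) ^ k)"
    using upper_triangular_pow[OF B ut, of k] by simp
  also have "\<dots> = (\<Sum>a\<leftarrow>es. a ^ k)"
    using B by (simp add: diag[symmetric] diag_mat_def interv_sum_list_conv_sum_set_nat o_def lessThan_atLeast0)
  finally show ?thesis .
qed

text \<open>Turns multiplicities of eigenvalues into counts in the multiset of roots, where symmetry
  about the origin becomes invariance under negation.\<close>

lemma order_prod_linear_factors:
  fixes x :: "'a :: idom"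
  shows "Polynomial.order x (\<Prod>a\<leftarrow>es. [:- a, 1:]) = count (mset es) x"
proof (induction es)
  case (Cons a es)
  have "Polynomial.order x [:- a, 1:] = (if x = a then 1 else 0)"
    using order_power_n_n[of a 1] by (auto intro: order_0I)
  moreover have nz: "(\<Prod>a\<leftarrow>es. [:- a, 1:]) \<noteq> 0"
    by (auto simp: prod_list_zero_iff)
  then have "Polynomial.order x ([:- a, 1:] * (\<Prod>a\<leftarrow>es. [:- a, 1:]))
      = Polynomial.order x [:- a, 1:] + Polynomial.order x (\<Prod>a\<leftarrow>es. [:- a, 1:])"
    by (intro order_mult) (simp del: mult_pCons_left)
  ultimately show ?case using Cons by simp
qed simp

text \<open>Equal multiplicities of \<open>k\<close> and \<open>- k\<close> make the multiset of
  eigenvalues invariant under negation. Its sum of odd powers is therefore its own negative.\<close>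

lemma trace_odd_pow_eq_0:
  fixes A :: "real mat"
  assumes A: "A \<in> carrier_mat n n" and sym: "\<And>i j. i < n \<Longrightarrow> j < n \<Longrightarrow> A $$ (i, j) = A $$ (j, i)"
    and mult: "\<And>k. eigenvalue_multiplicity A k = eigenvalue_multiplicity A (- k)"
    and "odd m"
  shows "(\<Sum>i<n. (A ^\<^sub>m m) $$ (i, i)) = 0"
proof -
  obtain es where es: "char_poly A = (\<Prod>a\<leftarrow>es. [:- a, 1:])"
    using real_symmetric_char_poly_splits[OF A sym] by blast
  have "mset es = image_mset uminus (mset es)"
  proof (rule multiset_eqI)
    fix x :: real
    have "uminus -` {x} = {- x}"
      by (auto simp: equation_minus_iff)
    \<comment> \<open>The count in the image sums over the preimages of \<open>x\<close> that occur
      in \<open>es\<close>. The only candidate is \<open>- x\<close>, so the two cases are whether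
      it occurs.\<close>
    then have "count (image_mset uminus (mset es)) x = count (mset es) (- x)"
      by (cases "- x \<in> set es") (auto simp: count_image_mset count_eq_zero_iff)
    then show "count (mset es) x = count (image_mset uminus (mset es)) x"
      using mult[of x] by (simp add: eigenvalue_multiplicity_def es order_prod_linear_factors)
  qed
  then have "(\<Sum>a\<in>#mset es. a ^ m) = (\<Sum>a\<in>#image_mset uminus (mset es). a ^ m)" by simp
  also have "\<dots> = (\<Sum>a\<in>#mset es. - (a ^ m))"
    using \<open>odd m\<close> by (simp add: image_mset.compositionality o_def)
  also have "\<dots> = - (\<Sum>a\<in>#mset es. a ^ m)" by (induction es) auto
  finally have "(\<Sum>a\<in>#mset es. a ^ m) = 0" by simp
  moreover have "(\<Sum>a\<leftarrow>es. a ^ m) = (\<Sum>a\<in>#mset es. a ^ m)" by (simp flip: sum_mset_sum_list mset_map)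
  ultimately show ?thesis using trace_pow_eq_sum_roots[OF A es, of m] by simp
qed

text \<open>The trace of the cube is a sum over closed walks of length 3, each weighted by the
  product of its three entries. All weights are nonnegative, and the walk \<open>i, j, k, i\<close>
  has positive weight.\<close>

lemma trace_cube_pos:
  fixes A :: "real mat"
  assumes A: "A \<in> carrier_mat n n" and nonneg: "\<And>i j. i < n \<Longrightarrow> j < n \<Longrightarrow> 0 \<le> A $$ (i, j)"
    and ijk: "i < n" "j < n" "k < n"
    and pos: "0 < A $$ (i, j)" "0 < A $$ (j, k)" "0 < A $$ (k, i)"
  shows "0 < (\<Sum>i<n. (A ^\<^sub>m 3) $$ (i, i))"
proof -
  have "(A ^\<^sub>m 3) $$ (l, l) = (\<Sum>a<n. A $$ (l, a) * (\<Sum>b<n. A $$ (a, b) * A $$ (b, l)))" if "l < n" for l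
    using that A
    by (auto simp: numeral_3_eq_3 scalar_prod_def lessThan_atLeast0 intro!: sum.cong)
  then have eq: "(\<Sum>i<n. (A ^\<^sub>m 3) $$ (i, i))
      = (\<Sum>l<n. \<Sum>a<n. A $$ (l, a) * (\<Sum>b<n. A $$ (a, b) * A $$ (b, l)))" by simp
  show ?thesis unfolding eq
    using ijk pos nonneg
    by (intro sum_pos2[of _ i] sum_pos2[of _ j] sum_pos2[of _ k] sum_nonneg mult_nonneg_nonneg mult_pos_pos) auto
qed

section \<open>Distances in trees\<close>

text \<open>A local substitute for distinctness: when two walks are glued it only has to be checked
  at the junction. For vertex walks in a tree the two notions turn out to agree.\<close>

fun non_backtracking :: "'a list \<Rightarrow> bool" where
  "non_backtracking (x # y # z # xs) \<longleftrightarrow> x \<noteq> z \<and> non_backtracking (y # z # xs)"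
| "non_backtracking xs \<longleftrightarrow> True"

lemma non_backtracking_ConsD: "non_backtracking (x # xs) \<Longrightarrow> non_backtracking xs"
  by (cases "x # xs" rule: non_backtracking.cases) auto

text \<open>Each triple of consecutive entries lies in one of the two overlapping lists, except the
  one centred at \<open>a\<close>. That triple exists only if \<open>xs\<close> and
  \<open>ys\<close> are both nonempty.\<close>

lemma non_backtracking_append:
  assumes "non_backtracking (xs @ [a])" and "non_backtracking (a # ys)"
    and "xs \<noteq> [] \<Longrightarrow> ys \<noteq> [] \<Longrightarrow> last xs \<noteq> hd ys"
  shows "non_backtracking (xs @ a # ys)"
  using assms
proof (induction xs rule: non_backtracking.induct)
  case ("2_2" v)
  then show ?case by (cases ys) auto
next
  case ("2_3" v w)
  then show ?case by (cases ys) auto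
qed auto

lemma non_backtracking_rev: "non_backtracking xs \<Longrightarrow> non_backtracking (rev xs)"
proof (induction xs rule: non_backtracking.induct)
  case (1 x y z xs)
  then have "non_backtracking (rev (z # xs) @ [y])" by simp
  then have "non_backtracking (rev (z # xs) @ y # [x])"
    by (rule non_backtracking_append) (use 1 in auto)
  then show ?case by simp
qed auto

lemma distinct_non_backtracking: "distinct xs \<Longrightarrow> non_backtracking xs"
  by (induction xs rule: non_backtracking.induct) auto

section \<open>Vertex walks and shortest paths\<close>

context wf_digraph
begin

lemma vwalk_appendI:
  "vwalk (xs @ [a]) G \<Longrightarrow> vwalk (a # ys) G \<Longrightarrow> vwalk (xs @ a # ys) G"
proof (induction xs)
  case (Cons x xs)
  then show ?case by (cases xs) auto
qed simp

text \<open>An arc is chosen for each pair of consecutive vertices. This lets vertex lists bound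
  \<open>graph_dist\<close>, which is defined by lists of arcs.\<close>

lemma vwalk_imp_awalk:
  assumes "vwalk xs G"
  shows "\<exists>p. awalk (hd xs) p (last xs) \<and> awalk_verts (hd xs) p = xs"
  using assms
proof (induction rule: vwalk_induct)
  case (Base u)
  then show ?case by (intro exI[of _ "[]"]) (auto simp: awalk_Nil_iff)
next
  case (Cons u v es)
  then obtain p where p: "awalk v p (last (v # es))" "awalk_verts v p = v # es" by auto
  from Cons(1) obtain e where "e \<in> arcs G" "tail G e = u" "head G e = v" by auto
  with p show ?case by (intro exI[of _ "e # p"]) (auto simp: awalk_Cons_iff)
qed

lemma graph_dist_le:
  assumes "vwalk xs G"
  shows "graph_dist G (hd xs) (last xs) \<le> length xs - 1"
proof -
  obtain p where p: "awalk (hd xs) p (last xs)" "awalk_verts (hd xs) p = xs"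
    using vwalk_imp_awalk[OF assms] by blast
  from p(2) have "length p = length xs - 1" using length_awalk_verts[of "hd xs" p] by simp
  then show ?thesis unfolding graph_dist_def using p(1) by (intro Least_le) blast
qed

text \<open>A walk of minimal length repeats no vertex, since the detour between two occurrences
  could be cut out.\<close>

lemma shortest_path_exists:
  assumes "strongly_connected G" "u \<in> verts G" "v \<in> verts G"
  obtains xs where "vpath xs G" "hd xs = u" "last xs = v" "length xs = Suc (graph_dist G u v)"
proof -
  have "\<exists>n p. awalk u p v \<and> length p = n"
    using assms by (auto simp: strongly_connected_def reachable_awalk)
  then have "\<exists>p. awalk u p v \<and> length p = graph_dist G u v"
    unfolding graph_dist_def by (rule LeastI_ex)
  then obtain p where p: "awalk u p v" "length p = graph_dist G u v" by blast
  define xs where "xs = awalk_verts u p"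
  have w: "vwalk xs G" "hd xs = u" "last xs = v" "length xs = Suc (graph_dist G u v)"
    using awalk_imp_vwalk p by (auto simp: xs_def length_awalk_verts awhd_if_cas awlast_if_cas awalk_def)
  have "distinct xs"
  proof (rule ccontr)
    assume "\<not> distinct xs"
    then obtain as bs cs y where xs: "xs = as @ [y] @ bs @ [y] @ cs"
      using not_distinct_decomp by blast
    have "vwalk (as @ [y]) G" using w(1) unfolding xs
      by (intro vwalkI_append_l[of "as @ [y]" "bs @ [y] @ cs"]) simp_all
    moreover have "vwalk (y # cs) G" using w(1) unfolding xs
      by (intro vwalkI_append_r[of "y # cs" "as @ [y] @ bs"]) simp_all
    \<comment> \<open>The detour \<open>bs @ [y]\<close> is dropped. Both endpoints stay the same,
      so this walk is too short.\<close>
    ultimately have "vwalk (as @ y # cs) G" by (rule vwalk_appendI)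
    from graph_dist_le[OF this] have "graph_dist G u v \<le> length (as @ y # cs) - 1"
      using w(2,3) by (cases as) (auto simp: xs)
    with w(4) show False by (simp add: xs)
  qed
  with w show ?thesis by (intro that[of xs]) (simp_all add: vpath_def)
qed

end

section \<open>Uniqueness of paths and distances in trees\<close>

locale undirected_tree_graph = graph G for G :: "('a, 'b) pre_digraph" (structure) +
  assumes connected: "connected G"
    and acyclic: "cycle p \<Longrightarrow> length p < 3"
begin

text \<open>By induction the tail is distinct. If the first vertex recurred in it, the walk up to
  that recurrence would be a cycle, and without backtracking or loops it would have at least three
  arcs.\<close>

lemma non_backtracking_vwalk_distinct:
  "vwalk xs G \<Longrightarrow> non_backtracking xs \<Longrightarrow> distinct xs"
proof (induction xs rule: list.induct)
  case (Cons x xs)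
  then have dist: "distinct xs"
    by (cases xs) (auto dest: non_backtracking_ConsD)
  moreover have "x \<notin> set xs"
  proof
    assume "x \<in> set xs"
    then obtain ys zs where xs: "xs = ys @ x # zs" by (auto dest: split_list)
    have w: "vwalk (x # ys @ [x]) G"
      using Cons.prems(1) unfolding xs
      by (intro vwalkI_append_l[of "x # ys @ [x]" zs]) simp_all
    \<comment> \<open>An empty \<open>ys\<close> would give a loop at \<open>x\<close>, and a single
      vertex in \<open>ys\<close> would give an immediate return to \<open>x\<close>.\<close>
    have ys: "length ys \<ge> 2"
    proof (cases "x # ys" rule: non_backtracking.cases)
      case (1 a b c cs)
      then show ?thesis by auto
    next
      case ("2_2" v)
      then show ?thesis using w adj_not_same by auto
    next
      case ("2_3" v y)
      then show ?thesis using Cons.prems(2) by (auto simp: xs)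
    qed simp
    from vwalk_imp_awalk[OF w] obtain p where
      p: "awalk x p x" "awalk_verts x p = x # ys @ [x]" by auto
    have len: "length p = Suc (length ys)" using p(2) length_awalk_verts[of x p] by simp
    have "cycle p" unfolding cycle_def
      using p dist len by (intro exI[of _ x]) (auto simp: xs)
    with acyclic[of p] ys len show False by simp
  qed
  ultimately show ?case by simp
qed simp

text \<open>Where two such walks diverge, reversing one and continuing along the other gives a
  non-backtracking walk. It would have to be distinct, yet it starts and ends at the common last
  vertex.\<close>

lemma non_backtracking_vwalk_unique:
  assumes "vwalk xs G" "non_backtracking xs" "vwalk ys G" "non_backtracking ys"
    and "hd xs = hd ys" "last xs = last ys"
  shows "xs = ys"
  using assms
proof (induction xs arbitrary: ys rule: list.induct)
  case (Cons a xs)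
  obtain zs where ys: "ys = a # zs" using Cons.prems(3,5) by (cases ys) auto
  have dist: "distinct (a # xs)" "distinct (a # zs)"
    using Cons.prems non_backtracking_vwalk_distinct ys by blast+
  show ?case
  \<comment> \<open>If one walk is just \<open>[a]\<close>, the other also ends at \<open>a\<close>,
    so by distinctness it is \<open>[a]\<close> too.\<close>
  proof (cases "xs = [] \<or> zs = []")
    case True
    then show ?thesis using Cons.prems dist ys last_in_set by (auto split: if_splits)
  next
    case False
    have w: "vwalk xs G" "vwalk zs G"
      using Cons.prems(1,3) False ys by (auto elim: vwalk_consE)
    have nb: "non_backtracking xs" "non_backtracking zs"
      using Cons.prems(2,4) ys by (auto dest: non_backtracking_ConsD)
    have "hd xs = hd zs"
    proof (rule ccontr)
      assume ne: "hd xs \<noteq> hd zs"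
      have "vwalk (rev xs @ [a]) G"
        using vwalk_rev_ex[OF sym_arcs Cons.prems(1)] by simp
      moreover have "vwalk (a # zs) G" using Cons.prems(3) ys by simp
      ultimately have "vwalk (rev xs @ a # zs) G" by (rule vwalk_appendI)
      moreover have "non_backtracking (rev xs @ a # zs)"
      proof (rule non_backtracking_append)
        show "non_backtracking (rev xs @ [a])"
          using non_backtracking_rev[OF Cons.prems(2)] by simp
        show "non_backtracking (a # zs)" using Cons.prems(4) ys by simp
        show "last (rev xs) \<noteq> hd zs" using ne False by (simp add: last_rev)
      qed
      ultimately have "distinct (rev xs @ a # zs)"
        by (rule non_backtracking_vwalk_distinct)
      moreover have "last xs = last zs" using Cons.prems(6) ys False by simp
      ultimately show False using False last_in_set[of xs] last_in_set[of zs] by auto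
    qed
    then show ?thesis
      using Cons.IH[OF w(1) nb(1) w(2) nb(2)] Cons.prems(6) ys False by simp
  qed
qed auto

lemma strongly_connected: "strongly_connected G"
  by (rule symmetric_connected_imp_strongly_connected[OF sym_arcs connected])

text \<open>A shortest path is non-backtracking, so by uniqueness it is the given walk. Distances
  can thus be read off any non-backtracking walk.\<close>

lemma graph_dist_non_backtracking:
  assumes "vwalk xs G" "non_backtracking xs"
  shows "graph_dist G (hd xs) (last xs) = length xs - 1"
proof -
  have "hd xs \<in> verts G" "last xs \<in> verts G"
    using assms(1) hd_in_set last_in_set by (metis subsetD vwalkE)+
  with strongly_connected obtain ys where ys: "vpath ys G" "hd ys = hd xs" "last ys = last xs"
    "length ys = Suc (graph_dist G (hd xs) (last xs))" by (rule shortest_path_exists)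
  then have "ys = xs"
    using assms by (intro non_backtracking_vwalk_unique) (auto intro: distinct_non_backtracking)
  with ys(4) show ?thesis by simp
qed

lemma graph_dist_sym:
  assumes "u \<in> verts G" "v \<in> verts G"
  shows "graph_dist G u v = graph_dist G v u"
proof -
  have "graph_dist G b a \<le> graph_dist G a b" if ab: "a \<in> verts G" "b \<in> verts G" for a b
  proof -
    from strongly_connected ab obtain xs where xs: "vpath xs G" "hd xs = a" "last xs = b"
      "length xs = Suc (graph_dist G a b)" by (rule shortest_path_exists)
    have "vwalk (rev xs) G" using xs(1) by (intro vwalk_rev_ex[OF sym_arcs]) auto
    from graph_dist_le[OF this] show ?thesis using xs by (auto simp: hd_rev last_rev)
  qed
  then show ?thesis using assms by (intro antisym) auto
qed

section \<open>Diameter, eccentricity and the centre\<close>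

lemma graph_dist_le_diameter:
  assumes "u \<in> verts G" "v \<in> verts G"
  shows "graph_dist G u v \<le> graph_diameter G"
  unfolding graph_diameter_def
proof (rule Max_ge)
  have "{graph_dist G u v |u v. u \<in> verts G \<and> v \<in> verts G}
      = (\<lambda>(u, v). graph_dist G u v) ` (verts G \<times> verts G)" by auto
  then show "finite {graph_dist G u v |u v. u \<in> verts G \<and> v \<in> verts G}" by simp
qed (use assms in blast)

lemma diameter_attained:
  obtains u v where "u \<in> verts G" "v \<in> verts G" "graph_dist G u v = graph_diameter G"
proof -
  have eq: "{graph_dist G u v |u v. u \<in> verts G \<and> v \<in> verts G}
      = (\<lambda>(u, v). graph_dist G u v) ` (verts G \<times> verts G)" by auto
  have "verts G \<noteq> {}" using connected by (auto simp: connected_def strongly_connected_def)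
  then have "graph_diameter G \<in> (\<lambda>(u, v). graph_dist G u v) ` (verts G \<times> verts G)"
    unfolding graph_diameter_def eq by (intro Max_in) auto
  then show ?thesis using that by auto
qed

lemma eccentricity_eqI:
  assumes "\<And>w. w \<in> verts G \<Longrightarrow> graph_dist G u w \<le> k"
    and "v \<in> verts G" "graph_dist G u v = k"
  shows "eccentricity G u = k"
proof -
  have "{graph_dist G u v | v. v \<in> verts G} = graph_dist G u ` verts G" by auto
  then show ?thesis
    unfolding eccentricity_def using assms by (auto intro!: Max_eqI)
qed

lemma diameter_pos:
  assumes "card (verts G) \<ge> 2"
  shows "graph_diameter G > 0"
proof -
  obtain u v where uv: "u \<in> verts G" "v \<in> verts G" "u \<noteq> v"
    using assms card_2_iff' obtain_subset_with_card_n[of 2 "verts G"] by (metis subsetD)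
  from strongly_connected uv(1,2) obtain xs where xs: "vpath xs G" "hd xs = u" "last xs = v"
      "length xs = Suc (graph_dist G u v)" by (rule shortest_path_exists)
  have "graph_dist G u v \<noteq> 0"
  proof
    assume "graph_dist G u v = 0"
    with xs(4) obtain x where "xs = [x]" by (auto simp: length_Suc_conv)
    with xs uv(3) show False by simp
  qed
  then show ?thesis using graph_dist_le_diameter[OF uv(1,2)] by simp
qed

text \<open>A path from \<open>w\<close> to the midpoint \<open>c\<close> of a diametral path arrives by an edge that differs from
  at least one of the two edges of the diametral path at \<open>c\<close>, so it extends to one of its ends.\<close>
lemma even_diameter_center:
  assumes "graph_diameter G = 2 * r" "r > 0"
  obtains c u v where "c \<in> verts G" "u \<in> verts G" "v \<in> verts G"
    "graph_dist G c u = r" "graph_dist G c v = r" "graph_dist G u v = 2 * r"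
    "eccentricity G c = r" "eccentricity G u = 2 * r" "eccentricity G v = 2 * r"
proof -
  obtain u v where uv: "u \<in> verts G" "v \<in> verts G" "graph_dist G u v = 2 * r"
    using diameter_attained assms by metis
  from strongly_connected uv(1,2) obtain xs where xs: "vpath xs G" "hd xs = u" "last xs = v"
      "length xs = Suc (2 * r)" using uv(3) by (metis shortest_path_exists)
  \<comment> \<open>The path has \<open>2 * r + 1\<close> vertices, so index \<open>r\<close> is the
    middle one, with \<open>r\<close> vertices on either side.\<close>
  define as c bs where "as = take r xs" and "c = xs ! r" and "bs = drop (Suc r) xs"
  have split: "xs = as @ c # bs"
    using xs(4) by (simp add: as_def c_def bs_def id_take_nth_drop)
  have len: "length as = r" "length bs = r" using xs(4) by (auto simp: as_def bs_def)
  with assms(2) have ne: "as \<noteq> []" "bs \<noteq> []" by auto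
  have dist: "distinct xs" and walk: "vwalk xs G" using xs(1) by auto
  have walk1: "vwalk (c # bs) G"
    using walk unfolding split by (rule vwalkI_append_r[rotated]) simp
  have "vwalk (as @ [c]) G"
    using walk unfolding split by (intro vwalkI_append_l[of "as @ [c]" bs]) simp_all
  from vwalk_rev_ex[OF sym_arcs this] have walk2: "vwalk (c # rev as) G" by simp
  have nb: "non_backtracking (c # bs)" "non_backtracking (c # rev as)"
    using dist unfolding split by (auto intro!: distinct_non_backtracking)
  have c: "c \<in> verts G" using walk1 by auto
  have hl: "last (c # bs) = v" "last (c # rev as) = u"
    using xs(2,3) ne by (auto simp: split last_rev)
  have dc: "graph_dist G c v = r" "graph_dist G c u = r"
    using graph_dist_non_backtracking[OF walk1 nb(1)] graph_dist_non_backtracking[OF walk2 nb(2)]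
    by (simp_all only: hl list.sel) (simp_all add: len)
  have le: "graph_dist G c w \<le> r" if w: "w \<in> verts G" for w
  proof -
    from strongly_connected w c obtain ps where ps: "vpath ps G" "hd ps = w" "last ps = c"
      "length ps = Suc (graph_dist G w c)" by (rule shortest_path_exists)
    define qs where "qs = butlast ps"
    have ps_eq: "ps = qs @ [c]" using ps(1,3) unfolding qs_def
      by (metis append_butlast_last_id vpathE vwalkE)
    have nbp: "non_backtracking (qs @ [c])" and wp: "vwalk (qs @ [c]) G"
      using ps(1) unfolding ps_eq[symmetric] vpath_def by (simp_all add: distinct_non_backtracking)
    \<comment> \<open>Stated for an arbitrary arm \<open>bs\<close> of length \<open>r\<close> at
      \<open>c\<close>, so that it applies to both halves of the diametral path. The walk from
      \<open>w\<close> through \<open>c\<close> along the arm has length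
      \<open>graph_dist G w c + r\<close>, which is a distance and hence at most
      \<open>2 * r\<close>.\<close>
    have extend: "graph_dist G w c \<le> r"
      if bs: "vwalk (c # bs) G" "non_backtracking (c # bs)" "length bs = r"
        "qs \<noteq> [] \<Longrightarrow> last qs \<noteq> hd bs" for bs
    proof -
      have vw: "vwalk (qs @ c # bs) G" using wp bs(1) by (rule vwalk_appendI)
      have "non_backtracking (qs @ c # bs)"
        by (rule non_backtracking_append[OF nbp bs(2) bs(4)])
      from graph_dist_non_backtracking[OF vw this]
      have "length (qs @ c # bs) - 1 \<le> graph_diameter G"
        using graph_dist_le_diameter[of "hd (qs @ c # bs)" "last (qs @ c # bs)"] vw
        by (metis hd_in_set last_in_set subsetD vwalkE)
      then show ?thesis using assms(1) bs(3) ps(4) by (simp add: ps_eq)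
    qed
    have "set as \<inter> set bs = {}" using dist by (simp add: split)
    then have "last as \<noteq> hd bs"
      using hd_in_set[OF ne(2)] last_in_set[OF ne(1)] by (metis disjoint_iff)
    \<comment> \<open>The two neighbours of \<open>c\<close> on the diametral path differ, so no
      vertex equals both. If \<open>qs\<close> is empty, \<open>last qs\<close> is an unspecified
      value, but the dichotomy still holds and \<open>extend\<close> then asks for no condition at
      the junction.\<close>
    then consider "last qs \<noteq> hd bs" | "last qs \<noteq> hd (rev as)" by (metis hd_rev)
    then have "graph_dist G w c \<le> r"
      using extend[OF walk1 nb(1) len(2)] extend[OF walk2 nb(2)] len(1) by cases simp_all
    then show ?thesis using graph_dist_sym[OF w c] by simp
  qed
  have "eccentricity G c = r"
    by (rule eccentricity_eqI[OF le uv(2) dc(1)])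
  moreover have "eccentricity G u = 2 * r"
    using uv assms(1) graph_dist_le_diameter by (metis eccentricity_eqI)
  moreover have "eccentricity G v = 2 * r"
    using uv assms(1) graph_dist_le_diameter graph_dist_sym by (metis eccentricity_eqI)
  ultimately show ?thesis using that[OF c uv(1,2) dc(2,1) uv(3)] by blast
qed

end

section \<open>The eccentricity matrix\<close>

lemma eccentricity_matrix_carrier: "eccentricity_matrix G vs \<in> carrier_mat (length vs) (length vs)"
  by (simp add: eccentricity_matrix_def)

lemma eccentricity_matrix_nonneg:
  "i < length vs \<Longrightarrow> j < length vs \<Longrightarrow> 0 \<le> eccentricity_matrix G vs $$ (i, j)"
  by (simp add: eccentricity_matrix_def)

lemma (in undirected_tree_graph) eccentricity_matrix_sym:
  assumes "set vs = verts G" "i < length vs" "j < length vs"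
  shows "eccentricity_matrix G vs $$ (i, j) = eccentricity_matrix G vs $$ (j, i)"
proof -
  have "vs ! i \<in> verts G" "vs ! j \<in> verts G" using assms nth_mem by blast+
  from graph_dist_sym[OF this] show ?thesis
    using assms(2,3) by (simp add: eccentricity_matrix_def min.commute)
qed

theorem theorem4p6:
  fixes T :: "('a, 'b) pre_digraph" and vs :: "'a list"
  assumes "undirected_tree T"
    and "card (verts T) \<ge> 2"
    and "even (graph_diameter T)"
    and "distinct vs" and "set vs = verts T"
  shows "\<exists>lam::real. eigenvalue_multiplicity (eccentricity_matrix T vs) lam
           \<noteq> eigenvalue_multiplicity (eccentricity_matrix T vs) (- lam)"
proof (rule ccontr)
  assume no: "\<not> ?thesis"
  interpret graph T using assms(1) by (simp add: undirected_tree_def)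
  interpret undirected_tree_graph T
    using assms(1) by unfold_locales (auto simp: undirected_tree_def not_le[symmetric])
  let ?E = "eccentricity_matrix T vs"
  obtain r where r: "graph_diameter T = 2 * r" using assms(3) by (rule evenE)
  with diameter_pos[OF assms(2)] have "r > 0" by simp
  with r obtain c u v where cuv: "c \<in> verts T" "u \<in> verts T" "v \<in> verts T"
    and d: "graph_dist T c u = r" "graph_dist T c v = r" "graph_dist T u v = 2 * r"
    and e: "eccentricity T c = r" "eccentricity T u = 2 * r" "eccentricity T v = 2 * r"
    by (rule even_diameter_center)
  obtain i j k where ijk: "i < length vs" "j < length vs" "k < length vs"
    and nth: "vs ! i = c" "vs ! j = u" "vs ! k = v"
    using cuv assms(5) by (metis in_set_conv_nth)
  \<comment> \<open>Each distance attains the smaller eccentricity: \<open>r\<close> is the minimum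
    of \<open>r\<close> and \<open>2 * r\<close> for the pairs with \<open>c\<close>, and
    \<open>2 * r\<close> is the eccentricity of both \<open>u\<close> and \<open>v\<close>. No entry
    of the triangle is therefore replaced by 0.\<close>
  have "0 < ?E $$ (i, j)" "0 < ?E $$ (j, k)" "0 < ?E $$ (i, k)"
    using ijk d e \<open>r > 0\<close> by (simp_all add: eccentricity_matrix_def nth)
  \<comment> \<open>Symmetry turns the third entry around, so that the three entries form the closed
    walk \<open>i, j, k, i\<close>.\<close>
  then have "0 < ?E $$ (i, j)" "0 < ?E $$ (j, k)" "0 < ?E $$ (k, i)"
    using eccentricity_matrix_sym[OF assms(5) ijk(1,3)] by simp_all
  from trace_cube_pos[OF eccentricity_matrix_carrier eccentricity_matrix_nonneg ijk this]
  have "0 < (\<Sum>i<length vs. (?E ^\<^sub>m 3) $$ (i, i))" by simp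
  moreover have "(\<Sum>i<length vs. (?E ^\<^sub>m 3) $$ (i, i)) = 0"
    by (rule trace_odd_pow_eq_0[OF eccentricity_matrix_carrier])
      (use no eccentricity_matrix_sym[OF assms(5)] in auto)
  ultimately show False by simp
qed

end
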